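(* Let $\mathfrak C$ be a permutational category with parent group $\Gamma$, and let $\mathcal O$ be an object of $\mathfrak C$ (not necessarily connected), identified with a permutation representation of $\Gamma$ on a set $\Omega$. Partition the set of connected components of $\mathcal O$ into its isomorphism classes $\{\mathcal O_{ij}\mid i\in I_j\}$ $(j\in J)$, so that $\mathcal O_{ij}\cong\mathcal O_{i'j'}$ if and only if $j=j'$. Let $\Omega_{ij}$ be the orbit of $\Gamma$ on $\Omega$ corresponding to $\mathcal O_{ij}$, let $C_{ij}$ be the centraliser of $\Gamma$ in ${\rm Sym}(\Omega_{ij})$, and let $\Delta_{ij}\le\Gamma$ be the stabiliser of a point of $\Omega_{ij}$. Then $C_{ij}\cong N_\Gamma(\Delta_{ij})/\Delta_{ij}$ for all $i,j$, and $${\rm Aut}_{\mathfrak C}(\mathcal O)\cong\prod_{j\in J}\bigl(C_{ij}\wr{\rm Sym}(I_j)\bigr),$$ the cartesian product over all $j\in J$ of the wreath products $C_{ij}\wr{\rm Sym}(I_j)$, where for each $j$ the index $i$ is any element of $I_j$.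
   Context: A permutational category $\mathfrak C$ with parent group $\Gamma$ is a category whose objects $\mathcal O$ are identified with the permutation representations $\theta:\Gamma\to S={\rm Sym}(\Omega)$ of the group $\Gamma$ on sets $\Omega$, and whose morphisms $\mathcal O_1\to\mathcal O_2$ are identified with the functions $\Omega_1\to\Omega_2$ commuting with the actions of $\Gamma$. All these groups and sets may be infinite. ${\rm Aut}_{\mathfrak C}(\mathcal O)$ is the group of all permutations of $\Omega$ commuting with the action of $\Gamma$, i.e. the centraliser of $\theta(\Gamma)$ in ${\rm Sym}(\Omega)$. An object is connected if $\Gamma$ acts transitively on the (non-empty) set $\Omega$. The connected components of $\mathcal O$ are the objects given by the restrictions of the action of $\Gamma$ to its orbits on $\Omega$. The centraliser of $\Gamma$ in ${\rm Sym}(\Omega_{ij})$ means the centraliser of the permutation group induced by $\Gamma$ on $\Omega_{ij}$. Cartesian products are unrestricted direct products. For a group $A$ and a set $I$, the wreath product $A\wr{\rm Sym}(I)$ is the semidirect product $A^{I}\rtimes{\rm Sym}(I)$, where the normal subgroup $A^I$ is the cartesian (unrestricted) product of copies of $A$ indexed by $I$ and ${\rm Sym}(I)$ acts by permuting the factors. Since the objects $\mathcal O_{ij}$ for fixed $j$ are mutually isomorphic, so are the groups $C_{ij}$ for fixed $j$. *)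

theory Defs
  imports "HOL-Algebra.Group_Action" "HOL-Algebra.Product_Groups"
begin

text \<open>
  An object of the permutational category with parent group \<open>\<Gamma>\<close> is a pair
  \<open>(\<Omega>, \<theta>)\<close> with \<^term>\<open>group_action \<Gamma> \<Omega> \<theta>\<close>; as in \<^const>\<open>BijGroup\<close>, maps between
  carrier sets are represented by extensional functions.
\<close>

definition equivariant_maps ::
    "('g, 'm) monoid_scheme \<Rightarrow> 'a set \<Rightarrow> ('g \<Rightarrow> 'a \<Rightarrow> 'a) \<Rightarrow> 'b set \<Rightarrow> ('g \<Rightarrow> 'b \<Rightarrow> 'b)
      \<Rightarrow> ('a \<Rightarrow> 'b) set"
  where "equivariant_maps \<Gamma> \<Omega>\<^sub>1 \<theta>\<^sub>1 \<Omega>\<^sub>2 \<theta>\<^sub>2 =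
    {f \<in> \<Omega>\<^sub>1 \<rightarrow>\<^sub>E \<Omega>\<^sub>2. \<forall>g \<in> carrier \<Gamma>. \<forall>x \<in> \<Omega>\<^sub>1. f (\<theta>\<^sub>1 g x) = \<theta>\<^sub>2 g (f x)}"

definition isomorphic_actions ::
    "('g, 'm) monoid_scheme \<Rightarrow> 'a set \<Rightarrow> ('g \<Rightarrow> 'a \<Rightarrow> 'a) \<Rightarrow> 'b set \<Rightarrow> ('g \<Rightarrow> 'b \<Rightarrow> 'b) \<Rightarrow> bool"
  where "isomorphic_actions \<Gamma> \<Omega>\<^sub>1 \<theta>\<^sub>1 \<Omega>\<^sub>2 \<theta>\<^sub>2 \<longleftrightarrow>
    (\<exists>f \<in> equivariant_maps \<Gamma> \<Omega>\<^sub>1 \<theta>\<^sub>1 \<Omega>\<^sub>2 \<theta>\<^sub>2. \<exists>h \<in> equivariant_maps \<Gamma> \<Omega>\<^sub>2 \<theta>\<^sub>2 \<Omega>\<^sub>1 \<theta>\<^sub>1.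
      compose \<Omega>\<^sub>1 h f = (\<lambda>x\<in>\<Omega>\<^sub>1. x) \<and> compose \<Omega>\<^sub>2 f h = (\<lambda>y\<in>\<Omega>\<^sub>2. y))"

definition action_aut_group ::
    "('g, 'm) monoid_scheme \<Rightarrow> 'a set \<Rightarrow> ('g \<Rightarrow> 'a \<Rightarrow> 'a) \<Rightarrow> ('a \<Rightarrow> 'a) monoid"
  where "action_aut_group \<Gamma> \<Omega> \<theta> =
    (BijGroup \<Omega>)\<lparr>carrier := Bij \<Omega> \<inter> equivariant_maps \<Gamma> \<Omega> \<theta> \<Omega> \<theta>\<rparr>"

definition restrict_action :: "('g \<Rightarrow> 'a \<Rightarrow> 'a) \<Rightarrow> 'a set \<Rightarrow> 'g \<Rightarrow> 'a \<Rightarrow> 'a"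
  where "restrict_action \<theta> X g = restrict (\<theta> g) X"

definition centraliser :: "('g, 'm) monoid_scheme \<Rightarrow> 'g set \<Rightarrow> 'g set"
  where "centraliser G S = {x \<in> carrier G. \<forall>s \<in> S. x \<otimes>\<^bsub>G\<^esub> s = s \<otimes>\<^bsub>G\<^esub> x}"

definition orbit_centraliser ::
    "('g, 'm) monoid_scheme \<Rightarrow> ('g \<Rightarrow> 'a \<Rightarrow> 'a) \<Rightarrow> 'a set \<Rightarrow> ('a \<Rightarrow> 'a) monoid"
  where "orbit_centraliser \<Gamma> \<theta> X =
    (BijGroup X)\<lparr>carrier := centraliser (BijGroup X) (restrict_action \<theta> X ` carrier \<Gamma>)\<rparr>"

definition semidirect_product ::
    "('n, 'm) monoid_scheme \<Rightarrow> ('h, 'k) monoid_scheme \<Rightarrow> ('h \<Rightarrow> 'n \<Rightarrow> 'n) \<Rightarrow> ('n \<times> 'h) monoid"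
  where "semidirect_product N H \<alpha> =
    \<lparr>carrier = carrier N \<times> carrier H,
     mult = \<lambda>(n, h) (n', h'). (n \<otimes>\<^bsub>N\<^esub> \<alpha> h n', h \<otimes>\<^bsub>H\<^esub> h'),
     one = (\<one>\<^bsub>N\<^esub>, \<one>\<^bsub>H\<^esub>)\<rparr>"

text \<open>
  \<^const>\<open>BijGroup\<close> multiplies permutations from right to left, so the inverse
  makes the permutation of coordinates a left action.
\<close>

definition permute_coordinates :: "'i set \<Rightarrow> ('i \<Rightarrow> 'i) \<Rightarrow> ('i \<Rightarrow> 'c) \<Rightarrow> 'i \<Rightarrow> 'c"
  where "permute_coordinates I \<sigma> f = (\<lambda>i\<in>I. f (inv_into I \<sigma> i))"

definition wreath_Sym ::
    "('c, 'm) monoid_scheme \<Rightarrow> 'i set \<Rightarrow> (('i \<Rightarrow> 'c) \<times> ('i \<Rightarrow> 'i)) monoid"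
  where "wreath_Sym A I =
    semidirect_product (product_group I (\<lambda>_. A)) (BijGroup I) (permute_coordinates I)"

text \<open>
  The pairs \<open>(j, i)\<close> with \<open>j \<in> J\<close>, \<open>i \<in> I j\<close> index the connected components
  (the orbits \<open>Orb j i\<close>) without repetition, and the first index is the isomorphism class.
\<close>

definition components_by_iso_class ::
    "('g, 'm) monoid_scheme \<Rightarrow> 'a set \<Rightarrow> ('g \<Rightarrow> 'a \<Rightarrow> 'a)
      \<Rightarrow> 'j set \<Rightarrow> ('j \<Rightarrow> 'i set) \<Rightarrow> ('j \<Rightarrow> 'i \<Rightarrow> 'a set) \<Rightarrow> bool"
  where "components_by_iso_class \<Gamma> \<Omega> \<theta> J I Orb \<longleftrightarrow>
    (\<forall>j\<in>J. I j \<noteq> {}) \<and>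
    bij_betw (\<lambda>(j, i). Orb j i) (Sigma J I) (orbits \<Gamma> \<Omega> \<theta>) \<and>
    (\<forall>j\<in>J. \<forall>i\<in>I j. \<forall>j'\<in>J. \<forall>i'\<in>I j'.
      isomorphic_actions \<Gamma> (Orb j i) (restrict_action \<theta> (Orb j i))
        (Orb j' i') (restrict_action \<theta> (Orb j' i')) \<longleftrightarrow> j = j')"

lemma carrier_action_aut_group:
  assumes "group_action \<Gamma> \<Omega> \<theta>"
  shows "carrier (action_aut_group \<Gamma> \<Omega> \<theta>) = centraliser (BijGroup \<Omega>) (\<theta> ` carrier \<Gamma>)"
proof -
  interpret group_action \<Gamma> \<Omega> \<theta> by fact
  have ext: "f \<in> \<Omega> \<rightarrow>\<^sub>E \<Omega>" if "f \<in> Bij \<Omega>" for f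
    using Bij_imp_funcset[OF that] Bij_imp_extensional[OF that] by (simp add: PiE_def)
  have comm: "f \<otimes>\<^bsub>BijGroup \<Omega>\<^esub> \<theta> g = \<theta> g \<otimes>\<^bsub>BijGroup \<Omega>\<^esub> f \<longleftrightarrow>
      (\<forall>x\<in>\<Omega>. f (\<theta> g x) = \<theta> g (f x))"
    if "f \<in> Bij \<Omega>" "g \<in> carrier \<Gamma>" for f g
  proof -
    have "f \<otimes>\<^bsub>BijGroup \<Omega>\<^esub> \<theta> g = compose \<Omega> f (\<theta> g)"
      "\<theta> g \<otimes>\<^bsub>BijGroup \<Omega>\<^esub> f = compose \<Omega> (\<theta> g) f"
      using that bij_prop0[OF that(2)] by (simp_all add: BijGroup_def)
    moreover have "compose \<Omega> f (\<theta> g) = compose \<Omega> (\<theta> g) f \<longleftrightarrow>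
        (\<forall>x\<in>\<Omega>. f (\<theta> g x) = \<theta> g (f x))"
    proof
      assume eq: "compose \<Omega> f (\<theta> g) = compose \<Omega> (\<theta> g) f"
      show "\<forall>x\<in>\<Omega>. f (\<theta> g x) = \<theta> g (f x)"
        using fun_cong[OF eq] by (metis compose_eq)
    next
      assume "\<forall>x\<in>\<Omega>. f (\<theta> g x) = \<theta> g (f x)"
      then show "compose \<Omega> f (\<theta> g) = compose \<Omega> (\<theta> g) f"
        unfolding compose_def by (intro restrict_ext) simp
    qed
    ultimately show ?thesis by (simp only:)
  qed
  have "carrier (action_aut_group \<Gamma> \<Omega> \<theta>) =
      {f \<in> Bij \<Omega>. \<forall>g\<in>carrier \<Gamma>. \<forall>x\<in>\<Omega>. f (\<theta> g x) = \<theta> g (f x)}"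
    using ext by (auto simp: action_aut_group_def equivariant_maps_def)
  also have "\<dots> = {f \<in> Bij \<Omega>. \<forall>g\<in>carrier \<Gamma>. f \<otimes>\<^bsub>BijGroup \<Omega>\<^esub> \<theta> g = \<theta> g \<otimes>\<^bsub>BijGroup \<Omega>\<^esub> f}"
    using comm by blast
  also have "\<dots> = centraliser (BijGroup \<Omega>) (\<theta> ` carrier \<Gamma>)"
    by (simp add: centraliser_def BijGroup_def)
  finally show ?thesis .
qed

lemma group_semidirect_product:
  assumes "group N" "group H"
    and hom: "\<And>h. h \<in> carrier H \<Longrightarrow> \<alpha> h \<in> hom N N"
    and one: "\<And>n. n \<in> carrier N \<Longrightarrow> \<alpha> \<one>\<^bsub>H\<^esub> n = n"
    and mult: "\<And>h h' n. \<lbrakk>h \<in> carrier H; h' \<in> carrier H; n \<in> carrier N\<rbrakk>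
      \<Longrightarrow> \<alpha> (h \<otimes>\<^bsub>H\<^esub> h') n = \<alpha> h (\<alpha> h' n)"
  shows "group (semidirect_product N H \<alpha>)"
proof -
  interpret N: group N by fact
  interpret H: group H by fact
  have cl: "\<alpha> h n \<in> carrier N" if "h \<in> carrier H" "n \<in> carrier N" for h n
    using hom[OF that(1)] that(2) by (auto simp: hom_def)
  have mu: "\<alpha> h (n \<otimes>\<^bsub>N\<^esub> n') = \<alpha> h n \<otimes>\<^bsub>N\<^esub> \<alpha> h n'"
    if "h \<in> carrier H" "n \<in> carrier N" "n' \<in> carrier N" for h n n'
    using hom[OF that(1)] that(2,3) by (auto simp: hom_def)
  show ?thesis
  proof (rule groupI)
    fix x assume "x \<in> carrier (semidirect_product N H \<alpha>)"
    then obtain n h where x: "x = (n, h)" "n \<in> carrier N" "h \<in> carrier H"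
      by (auto simp: semidirect_product_def)
    let ?h = "inv\<^bsub>H\<^esub> h"
    have "\<alpha> ?h (inv\<^bsub>N\<^esub> n) \<otimes>\<^bsub>N\<^esub> \<alpha> ?h n = \<alpha> ?h \<one>\<^bsub>N\<^esub>"
      using x mu[of ?h "inv\<^bsub>N\<^esub> n" n] by simp
    also have "\<dots> = \<one>\<^bsub>N\<^esub>"
      using x hom[of ?h] N.group_axioms hom_one by blast
    finally show "\<exists>y\<in>carrier (semidirect_product N H \<alpha>).
        y \<otimes>\<^bsub>semidirect_product N H \<alpha>\<^esub> x = \<one>\<^bsub>semidirect_product N H \<alpha>\<^esub>"
      using x cl by (intro bexI[of _ "(\<alpha> ?h (inv\<^bsub>N\<^esub> n), ?h)"]) (auto simp: semidirect_product_def)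
  qed (auto simp: semidirect_product_def cl mu one mult N.m_assoc H.m_assoc)
qed

lemma group_wreath_Sym:
  assumes "group A"
  shows "group (wreath_Sym A I)"
proof -
  interpret A: group A by fact
  have inv_mem: "inv_into I \<sigma> i \<in> I" if "\<sigma> \<in> Bij I" "i \<in> I" for \<sigma> i
    using that by (rule Bij_inv_into_mem)
  have inv_comp: "inv_into I (compose I \<sigma> \<tau>) i = inv_into I \<tau> (inv_into I \<sigma> i)"
    if "\<sigma> \<in> Bij I" "\<tau> \<in> Bij I" "i \<in> I" for \<sigma> \<tau> i
  proof -
    have "inj_on (compose I \<sigma> \<tau>) I"
      using compose_Bij[OF that(1,2)] by (auto simp: Bij_def bij_betw_def)
    moreover have "compose I \<sigma> \<tau> (inv_into I \<tau> (inv_into I \<sigma> i)) = i"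
      using that inv_mem by (auto simp: compose_def Bij_def bij_betw_def f_inv_into_f)
    ultimately show ?thesis
      using that inv_mem by (metis inv_into_f_f)
  qed
  show ?thesis
    unfolding wreath_Sym_def
  proof (rule group_semidirect_product)
    show "group (product_group I (\<lambda>_. A))" by (simp add: assms)
    show "group (BijGroup I)" by (rule group_BijGroup)
    show "permute_coordinates I \<sigma> \<in> hom (product_group I (\<lambda>_. A)) (product_group I (\<lambda>_. A))"
      if "\<sigma> \<in> carrier (BijGroup I)" for \<sigma>
      using that inv_mem
      by (auto simp: hom_def permute_coordinates_def product_group_def BijGroup_def fun_eq_iff)
    show "permute_coordinates I \<one>\<^bsub>BijGroup I\<^esub> f = f"
      if "f \<in> carrier (product_group I (\<lambda>_. A))" for f
    proof
      fix i
      show "permute_coordinates I \<one>\<^bsub>BijGroup I\<^esub> f i = f i"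
      proof (cases "i \<in> I")
        case True
        then have "inv_into I (\<lambda>x\<in>I. x) i = i"
          using inv_into_f_f[of "\<lambda>x\<in>I. x" I i] by (auto simp: inj_on_def)
        with True show ?thesis by (simp add: permute_coordinates_def BijGroup_def)
      next
        case False
        then show ?thesis
          using that PiE_arb[of f I _ i] by (simp add: permute_coordinates_def)
      qed
    qed
    show "permute_coordinates I (\<sigma> \<otimes>\<^bsub>BijGroup I\<^esub> \<tau>) f =
        permute_coordinates I \<sigma> (permute_coordinates I \<tau> f)"
      if "\<sigma> \<in> carrier (BijGroup I)" "\<tau> \<in> carrier (BijGroup I)" for \<sigma> \<tau> f
    proof -
      have B: "\<sigma> \<in> Bij I" "\<tau> \<in> Bij I" using that by (simp_all add: BijGroup_def)
      then have "\<sigma> \<otimes>\<^bsub>BijGroup I\<^esub> \<tau> = compose I \<sigma> \<tau>" by (simp add: BijGroup_def)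
      then show ?thesis
        unfolding permute_coordinates_def using B inv_comp inv_mem
        by (intro restrict_ext) simp
    qed
  qed
qed

end

theory Submission
  imports Defs "HOL-Algebra.Zassenhaus"
begin

text \<open>
  The centraliser of a transitive action on \<open>X\<close> is controlled by one point. If \<open>x \<in> X\<close> has
  stabiliser \<open>\<Delta>\<close>, an equivariant permutation is determined by the image of \<open>x\<close>, which has again
  stabiliser \<open>\<Delta>\<close>; conversely every point with stabiliser \<open>\<Delta>\<close> is such an image. Since \<open>g x\<close> has
  stabiliser \<open>g \<Delta> g\<inverse>\<close>, the points in question are the \<open>n x\<close> with \<open>n \<in> N(\<Delta>)\<close>, and sending \<open>n\<close> to
  the equivariant permutation with \<open>x \<mapsto> n\<inverse> x\<close> is a homomorphism onto the centraliser with kernel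
  \<open>\<Delta>\<close> (\<open>action_aut_group_iso_normalizer_quotient\<close>).

  For a general action, an automorphism carries each orbit onto an isomorphic orbit, hence permutes
  the orbits inside each isomorphism class (\<open>action_aut_image_orbit\<close>). Fix in every class \<open>j\<close> one
  orbit \<open>X j\<close> and equivariant bijections \<open>t j i\<close> from \<open>X j\<close> to the orbits of the class. These turn
  \<open>\<Omega>\<close> into the disjoint union over \<open>j\<close> of the sets \<open>I j \<times> X j\<close>, where \<open>\<Gamma>\<close> moves only the second
  coordinate. In the coordinates, an automorphism is the same as a family, indexed by \<open>j\<close>, of pairs
  \<open>(f, \<sigma>)\<close> acting by \<open>(i, y) \<mapsto> (\<sigma> i, f (\<sigma> i) y)\<close>, with \<open>\<sigma>\<close> a permutation of \<open>I j\<close> and each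
  \<open>f k\<close> in the centraliser on \<open>X j\<close>. Such pairs compose exactly as the elements of the wreath
  product. The pairs for different \<open>j\<close> are independent of one another and may all be
  nontrivial at once, so the product of the wreath products is unrestricted (\<open>action_aut_group_iso_product\<close>).
\<close>

section \<open>Automorphism groups of actions\<close>

lemma (in group) subgroup_centraliser:
  assumes "S \<subseteq> carrier G"
  shows "subgroup (centraliser G S) G"
proof (rule subgroupI)
  show "centraliser G S \<subseteq> carrier G" by (auto simp: centraliser_def)
  have "\<one> \<in> centraliser G S" using assms by (auto simp: centraliser_def)
  then show "centraliser G S \<noteq> {}" by blast
  show "inv a \<in> centraliser G S" if "a \<in> centraliser G S" for a
  proof -
    have a: "a \<in> carrier G" using that by (simp add: centraliser_def)
    have "inv a \<otimes> s = s \<otimes> inv a" if s: "s \<in> S" for s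
    proof -
      have sG: "s \<in> carrier G" using s assms by blast
      have "a \<otimes> s = s \<otimes> a" using s \<open>a \<in> centraliser G S\<close> by (simp add: centraliser_def)
      then have "a \<otimes> (s \<otimes> inv a) = s"
        using a sG by (simp flip: m_assoc) (simp add: m_assoc)
      then show ?thesis using a sG inv_solve_left[of "s \<otimes> inv a" a s] by simp
    qed
    with a show ?thesis by (simp add: centraliser_def)
  qed
  show "a \<otimes> b \<in> centraliser G S" if "a \<in> centraliser G S" "b \<in> centraliser G S" for a b
  proof -
    have "(a \<otimes> b) \<otimes> s = s \<otimes> (a \<otimes> b)" if s: "s \<in> S" for s
    proof -
      have c: "a \<in> carrier G" "b \<in> carrier G" "s \<in> carrier G"
        and e: "a \<otimes> s = s \<otimes> a" "b \<otimes> s = s \<otimes> b"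
        using that \<open>a \<in> _\<close> \<open>b \<in> _\<close> assms by (auto simp: centraliser_def)
      have "(a \<otimes> b) \<otimes> s = a \<otimes> (s \<otimes> b)" using c e by (simp add: m_assoc)
      also have "\<dots> = (s \<otimes> a) \<otimes> b" using c e by (simp flip: m_assoc)
      finally show ?thesis using c by (simp add: m_assoc)
    qed
    then show ?thesis using that by (auto simp: centraliser_def)
  qed
qed

lemma mem_action_aut_group:
  "f \<in> carrier (action_aut_group G E \<phi>) \<longleftrightarrow>
    f \<in> Bij E \<and> (\<forall>g\<in>carrier G. \<forall>x\<in>E. f (\<phi> g x) = \<phi> g (f x))"
proof -
  have "f \<in> E \<rightarrow>\<^sub>E E" if "f \<in> Bij E"
    using Bij_imp_funcset[OF that] Bij_imp_extensional[OF that] by (simp add: PiE_def)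
  then show ?thesis
    by (auto simp: action_aut_group_def equivariant_maps_def)
qed

lemma mult_action_aut_group:
  assumes "f \<in> carrier (action_aut_group G E \<phi>)" "h \<in> carrier (action_aut_group G E \<phi>)"
  shows "f \<otimes>\<^bsub>action_aut_group G E \<phi>\<^esub> h = compose E f h"
  using assms by (simp add: mem_action_aut_group) (simp add: action_aut_group_def BijGroup_def)

lemma (in group_action) group_action_aut_group: "group (action_aut_group G E \<phi>)"
proof -
  have "subgroup (carrier (action_aut_group G E \<phi>)) (BijGroup E)"
    unfolding carrier_action_aut_group[OF group_action_axioms]
    using bij_prop0 by (intro group.subgroup_centraliser group_BijGroup) (auto simp: BijGroup_def)
  then have "group ((BijGroup E)\<lparr>carrier := carrier (action_aut_group G E \<phi>)\<rparr>)"
    by (intro subgroup.subgroup_is_group group_BijGroup)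
  then show ?thesis by (simp add: action_aut_group_def)
qed

lemma (in group_action) action_aut_inverse:
  assumes "f \<in> carrier (action_aut_group G E \<phi>)"
  shows "\<exists>h\<in>carrier (action_aut_group G E \<phi>).
    (\<forall>x\<in>E. h (f x) = x) \<and> (\<forall>x\<in>E. f (h x) = x)"
proof -
  interpret A: group "action_aut_group G E \<phi>" by (rule group_action_aut_group)
  let ?h = "inv\<^bsub>action_aut_group G E \<phi>\<^esub> f"
  have h: "?h \<in> carrier (action_aut_group G E \<phi>)" using assms by simp
  have "compose E ?h f = (\<lambda>x\<in>E. x)" "compose E f ?h = (\<lambda>x\<in>E. x)"
    using A.l_inv[OF assms] A.r_inv[OF assms] assms h
    by (simp_all add: mult_action_aut_group) (simp_all add: action_aut_group_def BijGroup_def)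
  then have "?h (f x) = x" "f (?h x) = x" if "x \<in> E" for x
    using that by (metis compose_eq restrict_apply')+
  with h show ?thesis by blast
qed

section \<open>Restriction to orbits\<close>

lemma (in group_action) orbit_subset_carrier:
  assumes "X \<in> orbits G E \<phi>"
  shows "X \<subseteq> E"
  using assms orbits_coverture by blast

lemma (in group_action) orbit_closed:
  assumes "X \<in> orbits G E \<phi>" "g \<in> carrier G" "x \<in> X"
  shows "\<phi> g x \<in> X"
proof -
  obtain y h where y: "y \<in> E" "X = orbit G \<phi> y" "h \<in> carrier G" "x = \<phi> h y"
    using assms(1,3) by (auto simp: orbits_def orbit_def)
  have "\<phi> g x = \<phi> (g \<otimes> h) y"
    using y assms by (simp add: composition_rule)
  moreover have "g \<otimes> h \<in> carrier G"
    using y assms group_hom group_hom.axioms(1) group.is_monoid monoid.m_closed by metis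
  ultimately show ?thesis using y by (auto simp: orbit_def)
qed

lemma (in group_action) orbit_transitive:
  assumes "X \<in> orbits G E \<phi>" "x \<in> X" "y \<in> X"
  shows "\<exists>g\<in>carrier G. \<phi> g x = y"
proof -
  obtain z where z: "z \<in> E" "X = orbit G \<phi> z" using assms by (auto simp: orbits_def)
  have "y \<in> orbit G \<phi> x"
    using assms z orbit_subset_carrier orbit_sym orbit_trans by (metis subsetD)
  then show ?thesis by (auto simp: orbit_def)
qed

lemma (in group_action) transitive_restrict_action:
  assumes "X \<in> orbits G E \<phi>"
  shows "transitive_action G X (restrict_action \<phi> X)"
proof -
  interpret G: group G using group_hom group_hom.axioms(1) by auto
  note XE = orbit_subset_carrier[OF assms] and cl = orbit_closed[OF assms]
  have ins: "x \<in> E" if "x \<in> X" for x using that XE by auto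
  have bij: "restrict_action \<phi> X g \<in> Bij X" if g: "g \<in> carrier G" for g
  proof -
    have "x \<in> \<phi> g ` X" if "x \<in> X" for x
    proof
      show "\<phi> (inv g) x \<in> X" using that g by (simp add: cl)
      show "x = \<phi> g (\<phi> (inv g) x)"
        using that g ins composition_rule[of x g "inv g"] id_eq_one
        by (metis G.inv_closed G.r_inv restrict_apply')
    qed
    moreover have "inj_on (\<phi> g) X" using inj_prop[OF g] XE by (rule inj_on_subset)
    ultimately have "bij_betw (\<phi> g) X X" using cl[OF g] by (auto simp: bij_betw_def)
    then show ?thesis by (simp add: Bij_def restrict_action_def cong: bij_betw_cong)
  qed
  have "restrict_action \<phi> X (g \<otimes> h) = compose X (restrict_action \<phi> X g) (restrict_action \<phi> X h)"
    if "g \<in> carrier G" "h \<in> carrier G" for g h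
    using that ins cl by (auto simp: restrict_action_def compose_def composition_rule)
  then have "restrict_action \<phi> X \<in> hom G (BijGroup X)"
    using bij by (auto simp: hom_def BijGroup_def)
  then have "group_action G X (restrict_action \<phi> X)"
    by (simp add: group_action_def group_hom_def group_hom_axioms_def group_BijGroup)
  then show ?thesis
    using orbit_transitive[OF assms]
    by (intro transitive_action.intro transitive_action_axioms.intro)
       (auto simp: restrict_action_def)
qed

text \<open>
  The centraliser of the permutation group induced on an orbit is itself an automorphism group of
  an action, so everything about automorphism groups applies to it.
\<close>

lemma (in group_action) orbit_centraliser_eq:
  assumes "X \<in> orbits G E \<phi>"
  shows "orbit_centraliser G \<phi> X = action_aut_group G X (restrict_action \<phi> X)"
proof -
  have "group_action G X (restrict_action \<phi> X)"
    using transitive_restrict_action[OF assms] by (rule transitive_action.axioms)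
  then show ?thesis
    using carrier_action_aut_group
    by (fastforce simp: orbit_centraliser_def action_aut_group_def)
qed

section \<open>The automorphism group of a transitive action\<close>

lemma (in group_action) same_image_iff_stabilizer:
  assumes "x \<in> E" "a \<in> carrier G" "b \<in> carrier G"
  shows "\<phi> a x = \<phi> b x \<longleftrightarrow> inv b \<otimes> a \<in> stabilizer G \<phi> x"
proof -
  interpret G: group G using group_hom group_hom.axioms(1) by auto
  have ax: "\<phi> a x \<in> E" using assms element_image by blast
  have *: "\<phi> (inv b \<otimes> a) x = \<phi> (inv b) (\<phi> a x)"
    using assms by (simp add: composition_rule)
  have "\<phi> b (\<phi> (inv b) (\<phi> a x)) = \<phi> a x"
    using ax assms composition_rule[of "\<phi> a x" b "inv b"] id_eq_one
    by (metis G.inv_closed G.r_inv restrict_apply')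
  then have "\<phi> a x = \<phi> b x \<longleftrightarrow> \<phi> (inv b) (\<phi> a x) = x"
    using assms orbit_sym_aux by metis
  then show ?thesis using assms * by (simp add: stabilizer_def)
qed

lemma (in group_action) stabilizer_image:
  assumes "x \<in> E" "n \<in> carrier G"
  shows "n <# stabilizer G \<phi> x #> inv n = stabilizer G \<phi> (\<phi> n x)"
proof -
  interpret G: group G using group_hom group_hom.axioms(1) by auto
  have conj: "\<phi> (n \<otimes> h \<otimes> inv n) (\<phi> n x) = \<phi> n (\<phi> h x)" if "h \<in> carrier G" for h
  proof -
    have "\<phi> (n \<otimes> h \<otimes> inv n) (\<phi> n x) = \<phi> (n \<otimes> h \<otimes> inv n \<otimes> n) x"
      using assms that by (simp add: composition_rule)
    also have "n \<otimes> h \<otimes> inv n \<otimes> n = n \<otimes> h" using assms that by (simp add: G.m_assoc)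
    finally show ?thesis using assms that by (simp add: composition_rule)
  qed
  have "g \<in> n <# stabilizer G \<phi> x #> inv n" if "g \<in> stabilizer G \<phi> (\<phi> n x)" for g
  proof -
    have g: "g \<in> carrier G" "\<phi> g (\<phi> n x) = \<phi> n x" using that by (auto simp: stabilizer_def)
    let ?h = "inv n \<otimes> (g \<otimes> n)"
    have "?h \<in> stabilizer G \<phi> x"
      using g assms by (subst same_image_iff_stabilizer[symmetric]) (auto simp: composition_rule)
    moreover have "g = n \<otimes> ?h \<otimes> inv n"
      using g assms by (metis G.inv_closed G.inv_solve_left G.inv_solve_right G.m_closed)
    ultimately show ?thesis by (auto simp: l_coset_def r_coset_def)
  qed
  moreover have "n <# stabilizer G \<phi> x #> inv n \<subseteq> stabilizer G \<phi> (\<phi> n x)"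
    using assms conj by (auto simp: l_coset_def r_coset_def stabilizer_def)
  ultimately show ?thesis by blast
qed

lemma (in group_action) mem_normalizer_stabilizer:
  assumes "x \<in> E"
  shows "n \<in> normalizer G (stabilizer G \<phi> x) \<longleftrightarrow>
    n \<in> carrier G \<and> stabilizer G \<phi> (\<phi> n x) = stabilizer G \<phi> x"
  using stabilizer_image[OF assms] stabilizer_subset[of x]
  by (auto simp: normalizer_def stabilizer_def[of G "\<lambda>g. \<lambda>H\<in>_. _ g H"])

lemma (in group_action) stabilizer_action_aut:
  assumes "f \<in> carrier (action_aut_group G E \<phi>)" "x \<in> E"
  shows "stabilizer G \<phi> (f x) = stabilizer G \<phi> x"
proof -
  have "inj_on f E" and eq: "\<And>g. g \<in> carrier G \<Longrightarrow> f (\<phi> g x) = \<phi> g (f x)"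
    using assms by (auto simp: mem_action_aut_group Bij_def bij_betw_def)
  then have "\<phi> g (f x) = f x \<longleftrightarrow> \<phi> g x = x" if "g \<in> carrier G" for g
    using that assms(2) element_image by (metis inj_on_eq_iff)
  then show ?thesis by (auto simp: stabilizer_def)
qed

lemma (in transitive_action) action_aut_eqI:
  assumes "f \<in> carrier (action_aut_group G E \<phi>)" "h \<in> carrier (action_aut_group G E \<phi>)"
    and "x \<in> E" "f x = h x"
  shows "f = h"
proof (rule extensionalityI)
  show "f \<in> extensional E" "h \<in> extensional E"
    using assms by (auto simp: mem_action_aut_group Bij_def)
  fix y assume "y \<in> E"
  then obtain g where "g \<in> carrier G" "y = \<phi> g x" using assms(3) unique_orbit by metis
  then show "f y = h y" using assms by (simp add: mem_action_aut_group)
qed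

text \<open>
  The map \<open>g x \<mapsto> g y\<close> is well defined and injective because \<open>g x = h x\<close> means that \<open>h\<inverse> g\<close>
  stabilises \<open>x\<close>, equivalently \<open>y\<close>; transitivity makes it total and surjective.
\<close>

lemma (in transitive_action) action_aut_exists:
  assumes x: "x \<in> E" and y: "y \<in> E" and stab: "stabilizer G \<phi> x = stabilizer G \<phi> y"
  shows "\<exists>f\<in>carrier (action_aut_group G E \<phi>). f x = y"
proof -
  interpret G: group G using group_hom group_hom.axioms(1) by auto
  have key: "\<phi> a x = \<phi> b x \<longleftrightarrow> \<phi> a y = \<phi> b y" if "a \<in> carrier G" "b \<in> carrier G" for a b
    using that x y stab by (simp add: same_image_iff_stabilizer)
  have cl: "\<phi> a z \<in> E" if "a \<in> carrier G" "z \<in> E" for a z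
    using that element_image by blast
  \<comment> \<open>\<open>p z\<close> is a chosen group element carrying the base point to \<open>z\<close>; by \<open>key\<close> the choice does not
    affect \<open>f\<close>.\<close>
  obtain p where p: "\<And>z. z \<in> E \<Longrightarrow> p z \<in> carrier G \<and> \<phi> (p z) x = z"
    using unique_orbit[OF x] by metis
  define f where "f = (\<lambda>z\<in>E. \<phi> (p z) y)"
  have f: "f (\<phi> a x) = \<phi> a y" if "a \<in> carrier G" for a
    using key[of "p (\<phi> a x)" a] p[OF cl[OF that x]] that cl[OF that x] unfolding f_def by (metis restrict_apply)
  have "inj_on f E"
  proof (rule inj_onI)
    fix z w assume "z \<in> E" "w \<in> E" "f z = f w"
    then show "z = w" using p[of z] p[of w] key[of "p z" "p w"] by (simp add: f_def)
  qed
  moreover have "f ` E = E"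
  proof
    show "f ` E \<subseteq> E" using p y cl by (auto simp: f_def)
    show "E \<subseteq> f ` E"
    proof
      fix w assume "w \<in> E"
      then obtain a where "a \<in> carrier G" "\<phi> a y = w" using unique_orbit y by blast
      then show "w \<in> f ` E" using f cl x by (metis image_eqI)
    qed
  qed
  moreover have "f (\<phi> g z) = \<phi> g (f z)" if "g \<in> carrier G" "z \<in> E" for g z
  proof -
    have "f (\<phi> g z) = f (\<phi> (g \<otimes> p z) x)" using that p[of z] x by (simp add: composition_rule)
    also have "\<dots> = \<phi> g (\<phi> (p z) y)" using that p[of z] y by (simp add: f composition_rule)
    finally show ?thesis using that by (simp add: f_def)
  qed
  ultimately have "f \<in> carrier (action_aut_group G E \<phi>)"
    by (simp add: mem_action_aut_group Bij_def bij_betw_def f_def)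
  moreover have "f x = y"
    using f[of \<one>] x y id_eq_one by (metis G.one_closed restrict_apply')
  ultimately show ?thesis by blast
qed

text \<open>
  The inverse in \<open>x \<mapsto> n\<inverse> x\<close> is forced: equivariant maps commute with the action, so
  \<open>h m (h n x) = h m (n\<inverse> x) = n\<inverse> (h m x) = n\<inverse> m\<inverse> x\<close>. Without it the map would reverse products.
\<close>

theorem (in transitive_action) action_aut_group_iso_normalizer_quotient:
  assumes x: "x \<in> E"
  shows "action_aut_group G E \<phi> \<cong>
    G\<lparr>carrier := normalizer G (stabilizer G \<phi> x)\<rparr> Mod stabilizer G \<phi> x"
proof -
  interpret G: group G using group_hom group_hom.axioms(1) by auto
  let ?D = "stabilizer G \<phi> x"
  let ?N = "G\<lparr>carrier := normalizer G ?D\<rparr>"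
  let ?A = "action_aut_group G E \<phi>"
  interpret A: group ?A by (rule group_action_aut_group)
  have sub: "subgroup (normalizer G ?D) G"
    by (intro G.normalizer_imp_subgroup stabilizer_subset)
  interpret N: group ?N by (intro subgroup.subgroup_is_group sub G.group_axioms)
  have cl: "\<phi> a z \<in> E" if "a \<in> carrier G" "z \<in> E" for a z
    using that element_image by blast
  have N: "n \<in> carrier G" "inv n \<in> normalizer G ?D" if "n \<in> normalizer G ?D" for n
    using that sub by (auto simp: subgroup_def)
  have "\<exists>f\<in>carrier ?A. f x = \<phi> (inv n) x" if "n \<in> normalizer G ?D" for n
    using N[OF that] x cl mem_normalizer_stabilizer[OF x, of "inv n"]
    by (intro action_aut_exists) auto
  then obtain h where h: "\<And>n. n \<in> normalizer G ?D \<Longrightarrow> h n \<in> carrier ?A \<and> h n x = \<phi> (inv n) x"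
    by metis
  have eqv: "f (\<phi> g x) = \<phi> g (f x)" if "f \<in> carrier ?A" "g \<in> carrier G" for f g
    using that x by (auto simp: mem_action_aut_group)
  have "h (m \<otimes> n) = h m \<otimes>\<^bsub>?A\<^esub> h n" if mn: "m \<in> normalizer G ?D" "n \<in> normalizer G ?D" for m n
  proof (rule action_aut_eqI[OF _ _ x])
    have mnN: "m \<otimes> n \<in> normalizer G ?D" using mn sub by (simp add: subgroup.m_closed)
    then show "h (m \<otimes> n) \<in> carrier ?A" "h m \<otimes>\<^bsub>?A\<^esub> h n \<in> carrier ?A" using h mn by auto
    have "h (m \<otimes> n) x = \<phi> (inv n \<otimes> inv m) x"
      using h[OF mnN] N mn by (simp add: G.inv_mult_group)
    also have "\<dots> = \<phi> (inv n) (\<phi> (inv m) x)"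
      using N mn x by (simp add: composition_rule)
    also have "\<dots> = h m (h n x)"
      using h mn N by (simp add: eqv)
    finally show "h (m \<otimes> n) x = (h m \<otimes>\<^bsub>?A\<^esub> h n) x"
      using h mn x by (simp add: mult_action_aut_group compose_eq)
  qed
  then have hom: "h \<in> hom ?N ?A" using h by (auto simp: hom_def)
  interpret H: group_hom ?N ?A h
    by (simp add: group_hom_def group_hom_axioms_def hom N.group_axioms A.group_axioms)
  have surj: "h ` carrier ?N = carrier ?A"
  proof
    show "h ` carrier ?N \<subseteq> carrier ?A" using h by auto
    show "carrier ?A \<subseteq> h ` carrier ?N"
    proof
      fix f assume f: "f \<in> carrier ?A"
      then have "f x \<in> E" using x by (auto simp: mem_action_aut_group Bij_def bij_betw_def)
      then obtain g where g: "g \<in> carrier G" "\<phi> g x = f x" using x unique_orbit by blast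
      then have "g \<in> normalizer G ?D"
        using stabilizer_action_aut[OF f x] by (simp add: mem_normalizer_stabilizer[OF x])
      then have n: "inv g \<in> normalizer G ?D" by (rule N)
      have "h (inv g) = f"
        using h[OF n] g by (intro action_aut_eqI[OF _ f x]) auto
      with n show "f \<in> h ` carrier ?N" by auto
    qed
  qed
  have id: "\<one>\<^bsub>?A\<^esub> x = x" using x by (simp add: action_aut_group_def BijGroup_def)
  have "h n = \<one>\<^bsub>?A\<^esub> \<longleftrightarrow> n \<in> ?D" if n: "n \<in> normalizer G ?D" for n
  proof -
    have "h n = \<one>\<^bsub>?A\<^esub> \<longleftrightarrow> \<phi> (inv n) x = x"
      using h[OF n] id action_aut_eqI[OF _ A.one_closed x] by metis
    also have "\<dots> \<longleftrightarrow> \<phi> n x = x"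
      using N[OF n] x orbit_sym_aux[of n x x] orbit_sym_aux[of "inv n" x x] by auto
    finally show ?thesis using N(1)[OF n] by (simp add: stabilizer_def)
  qed
  moreover have "?D \<subseteq> normalizer G ?D"
    using subgroup.subset[OF normal_imp_subgroup[OF G.subgroup_in_normalizer[OF stabilizer_subgroup[OF x]]]]
    by simp
  ultimately have "kernel ?N ?A h = ?D" by (auto simp: kernel_def)
  then have "?N Mod ?D \<cong> ?A" using H.FactGroup_iso[OF surj] by simp
  then show ?thesis
    by (rule group.iso_sym[OF normal.factorgroup_is_group
          [OF G.subgroup_in_normalizer[OF stabilizer_subgroup[OF x]]]])
qed

section \<open>Isomorphisms between orbits\<close>

lemma (in group_action) isomorphic_orbits_iff:
  assumes X: "X \<in> orbits G E \<phi>" and Y: "Y \<in> orbits G E \<phi>"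
  shows "isomorphic_actions G X (restrict_action \<phi> X) Y (restrict_action \<phi> Y) \<longleftrightarrow>
    (\<exists>f. bij_betw f X Y \<and> (\<forall>g\<in>carrier G. \<forall>x\<in>X. f (\<phi> g x) = \<phi> g (f x)))"
    (is "?iso \<longleftrightarrow> (\<exists>f. ?eqv f)")
proof
  assume ?iso
  then obtain f h where
    f: "f \<in> equivariant_maps G X (restrict_action \<phi> X) Y (restrict_action \<phi> Y)"
    and h: "h \<in> equivariant_maps G Y (restrict_action \<phi> Y) X (restrict_action \<phi> X)"
    and hf: "compose X h f = (\<lambda>x\<in>X. x)" and fh: "compose Y f h = (\<lambda>y\<in>Y. y)"
    by (auto simp: isomorphic_actions_def)
  have "bij_betw f X Y"
  proof (rule bij_betw_byWitness)
    show "\<forall>x\<in>X. h (f x) = x" "\<forall>y\<in>Y. f (h y) = y"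
      using hf fh by (metis compose_eq restrict_apply')+
    show "f ` X \<subseteq> Y" "h ` Y \<subseteq> X"
      using f h by (auto simp: equivariant_maps_def)
  qed
  moreover have "f (\<phi> g x) = \<phi> g (f x)" if "g \<in> carrier G" "x \<in> X" for g x
  proof -
    have "f x \<in> Y" using f that by (auto simp: equivariant_maps_def)
    then show ?thesis using f that by (auto simp: equivariant_maps_def restrict_action_def)
  qed
  ultimately show "\<exists>f. ?eqv f" by blast
next
  assume "\<exists>f. ?eqv f"
  then obtain f where bij: "bij_betw f X Y"
    and eqv: "\<And>g x. g \<in> carrier G \<Longrightarrow> x \<in> X \<Longrightarrow> f (\<phi> g x) = \<phi> g (f x)"
    by blast
  define h where "h = inv_into X f"
  have h: "h y \<in> X" "f (h y) = y" if "y \<in> Y" for y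
    using that bij by (auto simp: h_def bij_betw_def f_inv_into_f inv_into_into)
  have hf: "h (f x) = x" if "x \<in> X" for x
    using that bij by (simp add: h_def bij_betw_def)
  have fX: "f x \<in> Y" if "x \<in> X" for x using that bij by (auto simp: bij_betw_def)
  have hg: "h (\<phi> g y) = \<phi> g (h y)" if "g \<in> carrier G" "y \<in> Y" for g y
  proof -
    have "f (\<phi> g (h y)) = \<phi> g y" using that h by (simp add: eqv)
    then show ?thesis using hf that h orbit_closed[OF X] by metis
  qed
  have "restrict f X \<in> equivariant_maps G X (restrict_action \<phi> X) Y (restrict_action \<phi> Y)"
    using eqv fX orbit_closed[OF X] by (auto simp: equivariant_maps_def restrict_action_def)
  moreover have "restrict h Y \<in> equivariant_maps G Y (restrict_action \<phi> Y) X (restrict_action \<phi> X)"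
    using hg h orbit_closed[OF Y] by (auto simp: equivariant_maps_def restrict_action_def)
  moreover have "compose X (restrict h Y) (restrict f X) = (\<lambda>x\<in>X. x)"
    "compose Y (restrict f X) (restrict h Y) = (\<lambda>y\<in>Y. y)"
    using h hf fX by (auto simp: compose_def)
  ultimately show ?iso unfolding isomorphic_actions_def by blast
qed

lemma (in group_action) action_aut_image_orbit:
  assumes f: "f \<in> carrier (action_aut_group G E \<phi>)" and X: "X \<in> orbits G E \<phi>"
  shows "f ` X \<in> orbits G E \<phi>"
    and "isomorphic_actions G X (restrict_action \<phi> X) (f ` X) (restrict_action \<phi> (f ` X))"
proof -
  note XE = orbit_subset_carrier[OF X]
  have inj: "inj_on f E" and fE: "\<And>x. x \<in> E \<Longrightarrow> f x \<in> E"
    and eqv: "\<And>g x. g \<in> carrier G \<Longrightarrow> x \<in> E \<Longrightarrow> f (\<phi> g x) = \<phi> g (f x)"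
    using f by (auto simp: mem_action_aut_group Bij_def bij_betw_def)
  obtain x where x: "x \<in> E" "X = orbit G \<phi> x" using X by (auto simp: orbits_def)
  then have "f ` X = orbit G \<phi> (f x)" using eqv by (auto simp: orbit_def image_iff) metis
  then show img: "f ` X \<in> orbits G E \<phi>" using fE x by (auto simp: orbits_def)
  have "bij_betw f X (f ` X)" using inj XE by (auto simp: bij_betw_def intro: inj_on_subset)
  then show "isomorphic_actions G X (restrict_action \<phi> X) (f ` X) (restrict_action \<phi> (f ` X))"
    using eqv XE by (subst isomorphic_orbits_iff[OF X img]) blast
qed

section \<open>Wreath products\<close>

lemma carrier_wreath_Sym:
  "carrier (wreath_Sym A I) = (I \<rightarrow>\<^sub>E carrier A) \<times> Bij I"
  by (simp add: wreath_Sym_def semidirect_product_def BijGroup_def)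

lemma mult_wreath_Sym:
  assumes "s \<in> Bij I" "s' \<in> Bij I"
  shows "(f, s) \<otimes>\<^bsub>wreath_Sym A I\<^esub> (f', s') =
    ((\<lambda>i\<in>I. f i \<otimes>\<^bsub>A\<^esub> f' (inv_into I s i)), compose I s s')"
  using assms
  by (auto simp: wreath_Sym_def semidirect_product_def BijGroup_def permute_coordinates_def)

section \<open>Automorphisms in coordinates\<close>

text \<open>
  The setting of the coordinates \<open>(j, i, y)\<close>. The last assumption says that automorphisms preserve
  the first coordinate; it is what remains of the classification of the components by isomorphism.
\<close>

locale component_coordinates = group_action G E \<phi>
  for G (structure) and E :: "'a set" and \<phi> +
  fixes J :: "'j set" and I :: "'j \<Rightarrow> 'i set" and X :: "'j \<Rightarrow> 'a set"
    and t :: "'j \<Rightarrow> 'i \<Rightarrow> 'a \<Rightarrow> 'a"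
  assumes X_orbit: "j \<in> J \<Longrightarrow> X j \<in> orbits G E \<phi>"
    and bij: "bij_betw (\<lambda>(j, i, y). t j i y) (SIGMA j:J. I j \<times> X j) E"
    and eqv: "\<lbrakk>j \<in> J; i \<in> I j; y \<in> X j; g \<in> carrier G\<rbrakk> \<Longrightarrow> t j i (\<phi> g y) = \<phi> g (t j i y)"
    and aut_component: "\<lbrakk>f \<in> carrier (action_aut_group G E \<phi>); j \<in> J; i \<in> I j; y \<in> X j\<rbrakk>
      \<Longrightarrow> \<exists>k\<in>I j. \<exists>z\<in>X j. f (t j i y) = t j k z"
begin

abbreviation C where "C j \<equiv> orbit_centraliser G \<phi> (X j)"
definition P where "P = product_group J (\<lambda>j. wreath_Sym (C j) (I j))"

text \<open>
  The first component of \<open>F j\<close> is evaluated at the new index \<open>\<sigma> i\<close>, not at \<open>i\<close>: in the wreath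
  product the permutation acts on functions by \<open>f \<mapsto> f \<circ> \<sigma>\<inverse>\<close>, and only this convention makes the
  assignment multiplicative.
\<close>

definition assemble :: "('j \<Rightarrow> ('i \<Rightarrow> 'a \<Rightarrow> 'a) \<times> ('i \<Rightarrow> 'i)) \<Rightarrow> 'a \<Rightarrow> 'a" where
  "assemble F = (\<lambda>w\<in>E.
    case inv_into (SIGMA j:J. I j \<times> X j) (\<lambda>(j, i, y). t j i y) w of
      (j, i, y) \<Rightarrow> t j (snd (F j) i) (fst (F j) (snd (F j) i) y))"

lemma t_mem: "\<lbrakk>j \<in> J; i \<in> I j; y \<in> X j\<rbrakk> \<Longrightarrow> t j i y \<in> E"
  using bij by (force simp: bij_betw_def)

lemma t_inject:
  assumes "t j i y = t j' i' y'" "j \<in> J" "i \<in> I j" "y \<in> X j" "j' \<in> J" "i' \<in> I j'" "y' \<in> X j'"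
  shows "j = j' \<and> i = i' \<and> y = y'"
  using bij_betw_imp_inj_on[OF bij] assms by (auto dest!: inj_onD[of _ _ "(j, i, y)" "(j', i', y')"])

lemma t_cases:
  assumes "w \<in> E"
  obtains j i y where "j \<in> J" "i \<in> I j" "y \<in> X j" "w = t j i y"
  using bij_betw_imp_surj_on[OF bij] assms by (auto simp: image_iff)

lemma X_nonempty: "j \<in> J \<Longrightarrow> X j \<noteq> {}"
  using X_orbit[of j] orbit_refl by (auto simp: orbits_def)

lemma X_closed: "\<lbrakk>j \<in> J; g \<in> carrier G; y \<in> X j\<rbrakk> \<Longrightarrow> \<phi> g y \<in> X j"
  using X_orbit orbit_closed by blast

lemma mem_C:
  assumes "j \<in> J"
  shows "m \<in> carrier (C j) \<longleftrightarrow>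
    m \<in> Bij (X j) \<and> (\<forall>g\<in>carrier G. \<forall>y\<in>X j. m (\<phi> g y) = \<phi> g (m y))"
proof -
  have "m y \<in> X j" if "m \<in> Bij (X j)" "y \<in> X j" for y
    using that Bij_imp_funcset by blast
  then show ?thesis
    using assms X_closed
    by (simp add: orbit_centraliser_eq X_orbit mem_action_aut_group restrict_action_def cong: conj_cong)
qed

lemma mem_P:
  "F \<in> carrier P \<longleftrightarrow> F \<in> extensional J \<and> (\<forall>j\<in>J. snd (F j) \<in> Bij (I j) \<and>
    fst (F j) \<in> extensional (I j) \<and> (\<forall>k\<in>I j. fst (F j) k \<in> carrier (C j)))"
  by (auto simp: P_def carrier_wreath_Sym PiE_iff mem_Times_iff)

lemma P_mem:
  assumes "F \<in> carrier P" "j \<in> J" "i \<in> I j"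
  shows "snd (F j) i \<in> I j" "y \<in> X j \<Longrightarrow> fst (F j) i y \<in> X j"
  using assms Bij_imp_funcset[of "snd (F j)" "I j"] Bij_imp_funcset[of "fst (F j) i" "X j"]
  by (auto simp: mem_P mem_C)

lemma assemble_extensional: "assemble F \<in> extensional E"
  by (simp add: assemble_def)

lemma assemble_apply:
  assumes "j \<in> J" "i \<in> I j" "y \<in> X j"
  shows "assemble F (t j i y) = t j (snd (F j) i) (fst (F j) (snd (F j) i) y)"
proof -
  have "inv_into (SIGMA j:J. I j \<times> X j) (\<lambda>(j, i, y). t j i y) (t j i y) = (j, i, y)"
    using inv_into_f_f[OF bij_betw_imp_inj_on[OF bij], of "(j, i, y)"] assms by simp
  then show ?thesis using t_mem[OF assms] by (simp add: assemble_def)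
qed

lemma group_P: "group P"
  unfolding P_def
  by (intro product_group group_wreath_Sym)
     (simp add: orbit_centraliser_eq X_orbit group_action.group_action_aut_group
       transitive_action.axioms transitive_restrict_action)

lemma mult_P:
  assumes F: "F \<in> carrier P" and H: "H \<in> carrier P" and j: "j \<in> J" and i: "i \<in> I j"
  shows "snd ((F \<otimes>\<^bsub>P\<^esub> H) j) i = snd (F j) (snd (H j) i)"
    and "y \<in> X j \<Longrightarrow> fst ((F \<otimes>\<^bsub>P\<^esub> H) j) (snd (F j) i) y = fst (F j) (snd (F j) i) (fst (H j) i y)"
proof -
  have s: "snd (F j) \<in> Bij (I j)" "snd (H j) \<in> Bij (I j)" using F H j by (auto simp: mem_P)
  have *: "(F \<otimes>\<^bsub>P\<^esub> H) j = ((\<lambda>i\<in>I j. fst (F j) i \<otimes>\<^bsub>C j\<^esub> fst (H j) (inv_into (I j) (snd (F j)) i)),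
      compose (I j) (snd (F j)) (snd (H j)))"
    using j mult_wreath_Sym[OF s, where A = "C j" and f = "fst (F j)" and f' = "fst (H j)"] by (simp add: P_def)
  show "snd ((F \<otimes>\<^bsub>P\<^esub> H) j) i = snd (F j) (snd (H j) i)"
    unfolding * using i by (simp add: compose_eq)
  have k: "snd (F j) i \<in> I j" "inv_into (I j) (snd (F j)) (snd (F j) i) = i"
    using P_mem[OF F j i] s i by (auto simp: Bij_def bij_betw_def)
  have "fst (F j) (snd (F j) i) \<in> carrier (C j)" "fst (H j) i \<in> carrier (C j)"
    using F H j i k by (auto simp: mem_P)
  then show "fst ((F \<otimes>\<^bsub>P\<^esub> H) j) (snd (F j) i) y = fst (F j) (snd (F j) i) (fst (H j) i y)"
    if "y \<in> X j"
    unfolding * using k j that by (simp add: orbit_centraliser_eq X_orbit mult_action_aut_group compose_eq)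
qed

lemma assemble_mem:
  assumes "F \<in> carrier P" "w \<in> E"
  shows "assemble F w \<in> E"
proof -
  obtain j i y where "j \<in> J" "i \<in> I j" "y \<in> X j" "w = t j i y" using assms(2) by (rule t_cases)
  then show ?thesis using P_mem[OF assms(1)] by (simp add: assemble_apply t_mem)
qed

lemma assemble_mult:
  assumes F: "F \<in> carrier P" and H: "H \<in> carrier P" and w: "w \<in> E"
  shows "assemble (F \<otimes>\<^bsub>P\<^esub> H) w = assemble F (assemble H w)"
proof -
  obtain j i y where "j \<in> J" "i \<in> I j" "y \<in> X j" "w = t j i y" using w by (rule t_cases)
  then show ?thesis
    using mult_P[OF F H] P_mem[OF F] P_mem[OF H] by (simp add: assemble_apply)
qed

lemma assemble_one:
  assumes "w \<in> E"
  shows "assemble \<one>\<^bsub>P\<^esub> w = w"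
proof -
  obtain j i y where "j \<in> J" "i \<in> I j" "y \<in> X j" "w = t j i y" using assms by (rule t_cases)
  then show ?thesis
    by (simp add: P_def assemble_apply wreath_Sym_def semidirect_product_def BijGroup_def orbit_centraliser_def)
qed

text \<open>
  Bijectivity comes for free from the group structure: the family inverse to \<open>F\<close> assembles to
  an inverse map.
\<close>

lemma assemble_aut:
  assumes F: "F \<in> carrier P"
  shows "assemble F \<in> carrier (action_aut_group G E \<phi>)"
proof -
  interpret P: group P by (rule group_P)
  have F': "inv\<^bsub>P\<^esub> F \<in> carrier P" using F by (rule P.inv_closed)
  have "bij_betw (assemble F) E E"
  proof (rule bij_betw_byWitness)
    show "\<forall>w\<in>E. assemble (inv\<^bsub>P\<^esub> F) (assemble F w) = w"
      using assemble_mult[OF F' F] assemble_one P.l_inv[OF F] by metis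
    show "\<forall>w\<in>E. assemble F (assemble (inv\<^bsub>P\<^esub> F) w) = w"
      using assemble_mult[OF F F'] assemble_one P.r_inv[OF F] by metis
    show "assemble F ` E \<subseteq> E" "assemble (inv\<^bsub>P\<^esub> F) ` E \<subseteq> E"
      using assemble_mem F F' by blast+
  qed
  moreover have "assemble F (\<phi> g w) = \<phi> g (assemble F w)" if g: "g \<in> carrier G" and w: "w \<in> E" for g w
  proof -
    obtain j i y where c: "j \<in> J" "i \<in> I j" "y \<in> X j" "w = t j i y" using w by (rule t_cases)
    let ?k = "snd (F j) i"
    have k: "?k \<in> I j" using P_mem F c by blast
    then have "fst (F j) ?k \<in> carrier (C j)" using F c by (auto simp: mem_P)
    then have "fst (F j) ?k (\<phi> g y) = \<phi> g (fst (F j) ?k y)" using c g by (simp add: mem_C)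
    then show ?thesis
      using c g k P_mem(2)[OF F _ k] X_closed by (simp add: assemble_apply flip: eqv)
  qed
  ultimately show ?thesis by (auto simp: mem_action_aut_group Bij_def assemble_def)
qed

lemma assemble_inj: "inj_on assemble (carrier P)"
proof (rule inj_onI)
  fix F H assume F: "F \<in> carrier P" and H: "H \<in> carrier P" and eq: "assemble F = assemble H"
  have *: "snd (F j) i = snd (H j) i \<and> fst (F j) (snd (F j) i) y = fst (H j) (snd (F j) i) y"
    if "j \<in> J" "i \<in> I j" "y \<in> X j" for j i y
    using fun_cong[OF eq, of "t j i y"] that P_mem[OF F] P_mem[OF H]
    by (auto simp: assemble_apply dest!: t_inject)
  have "F j = H j" if j: "j \<in> J" for j
  proof (rule prod_eqI)
    have F': "snd (F j) \<in> Bij (I j)" "fst (F j) \<in> extensional (I j)"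
      and H': "snd (H j) \<in> Bij (I j)" "fst (H j) \<in> extensional (I j)"
      using F H j by (auto simp: mem_P)
    have "snd (F j) i = snd (H j) i" if "i \<in> I j" for i
      using * X_nonempty j that by blast
    then show "snd (F j) = snd (H j)"
      using F' H' by (intro extensionalityI[of _ "I j"]) (auto dest: Bij_imp_extensional)
    show "fst (F j) = fst (H j)"
    proof (rule extensionalityI[OF F'(2) H'(2)])
      fix k assume k: "k \<in> I j"
      then obtain i where i: "i \<in> I j" "k = snd (F j) i"
        using F'(1) by (auto simp: Bij_def bij_betw_def)
      have "fst (F j) k \<in> Bij (X j)" "fst (H j) k \<in> Bij (X j)"
        using F H j k by (auto simp: mem_P mem_C)
      moreover have "fst (F j) k y = fst (H j) k y" if "y \<in> X j" for y
        using * j i that by blast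
      ultimately show "fst (F j) k = fst (H j) k"
        by (intro extensionalityI[of _ "X j"]) (auto dest: Bij_imp_extensional)
    qed
  qed
  then show "F = H" using F H by (intro extensionalityI[of _ J]) (auto simp: mem_P)
qed

text \<open>
  The new index \<open>k\<close> cannot vary with \<open>y\<close>: the points \<open>t j i y\<close> for fixed \<open>i\<close> are translates of one
  another by group elements, and these leave the index alone.
\<close>

lemma aut_coordinates:
  assumes f: "f \<in> carrier (action_aut_group G E \<phi>)"
  shows "\<exists>s m. \<forall>j\<in>J. \<forall>i\<in>I j. s j i \<in> I j \<and>
    (\<forall>y\<in>X j. m j i y \<in> X j \<and> f (t j i y) = t j (s j i) (m j i y))"
proof -
  have "\<exists>k\<in>I j. \<exists>h. \<forall>y\<in>X j. h y \<in> X j \<and> f (t j i y) = t j k (h y)" if j: "j \<in> J" and i: "i \<in> I j" for j i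
  proof -
    obtain x where x: "x \<in> X j" using X_nonempty j by blast
    obtain k z where k: "k \<in> I j" and z: "z \<in> X j" "f (t j i x) = t j k z"
      using aut_component[OF f j i x] by blast
    have "\<exists>u\<in>X j. f (t j i y) = t j k u" if y: "y \<in> X j" for y
    proof -
      obtain g where g: "g \<in> carrier G" "\<phi> g x = y"
        using orbit_transitive[OF X_orbit[OF j] x y] by blast
      have "f (t j i y) = \<phi> g (f (t j i x))"
        using f g t_mem[OF j i x] eqv[OF j i x g(1)] by (auto simp: mem_action_aut_group)
      also have "\<dots> = t j k (\<phi> g z)" using eqv[OF j k z(1) g(1)] z by simp
      finally show ?thesis using X_closed[OF j g(1) z(1)] by blast
    qed
    then show ?thesis using k by metis
  qed
  then show ?thesis by metis
qed

text \<open>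
  Coordinates of \<open>f\<close> and of its inverse are inverse to each other, since coordinates are unique.
  This yields at once that the index map is a permutation and that each \<open>m j i\<close> is a bijection.
\<close>

lemma assemble_surj:
  assumes f: "f \<in> carrier (action_aut_group G E \<phi>)"
  shows "f \<in> assemble ` carrier P"
proof -
  obtain h where h: "h \<in> carrier (action_aut_group G E \<phi>)"
    and hf: "\<And>x. x \<in> E \<Longrightarrow> h (f x) = x" and fh: "\<And>x. x \<in> E \<Longrightarrow> f (h x) = x"
    using action_aut_inverse[OF f] by blast
  obtain s m where s: "\<And>j i. \<lbrakk>j \<in> J; i \<in> I j\<rbrakk> \<Longrightarrow> s j i \<in> I j"
    and m: "\<And>j i y. \<lbrakk>j \<in> J; i \<in> I j; y \<in> X j\<rbrakk> \<Longrightarrow> m j i y \<in> X j"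
    and fc: "\<And>j i y. \<lbrakk>j \<in> J; i \<in> I j; y \<in> X j\<rbrakk> \<Longrightarrow> f (t j i y) = t j (s j i) (m j i y)"
    using aut_coordinates[OF f] by blast
  obtain s' m' where s': "\<And>j i. \<lbrakk>j \<in> J; i \<in> I j\<rbrakk> \<Longrightarrow> s' j i \<in> I j"
    and m': "\<And>j i y. \<lbrakk>j \<in> J; i \<in> I j; y \<in> X j\<rbrakk> \<Longrightarrow> m' j i y \<in> X j"
    and hc: "\<And>j i y. \<lbrakk>j \<in> J; i \<in> I j; y \<in> X j\<rbrakk> \<Longrightarrow> h (t j i y) = t j (s' j i) (m' j i y)"
    using aut_coordinates[OF h] by blast
  have 1: "s' j (s j i) = i \<and> m' j (s j i) (m j i y) = y" if "j \<in> J" "i \<in> I j" "y \<in> X j" for j i y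
    using hf[OF t_mem[OF that]] that s m s' m' by (auto simp: fc hc dest!: t_inject)
  have 2: "s j (s' j i) = i \<and> m j (s' j i) (m' j i y) = y" if "j \<in> J" "i \<in> I j" "y \<in> X j" for j i y
    using fh[OF t_mem[OF that]] that s m s' m' by (auto simp: fc hc dest!: t_inject)
  have ss: "s' j (s j i) = i" "s j (s' j i) = i" if "j \<in> J" "i \<in> I j" for j i
    using 1 2 X_nonempty that by blast+
  \<comment> \<open>\<open>m j i\<close> is the map leaving component \<open>i\<close>, whereas \<open>fst (F j) k\<close> is the map arriving at
    component \<open>k\<close>; hence the reindexing by \<open>s' j\<close>.\<close>
  define F where "F = (\<lambda>j\<in>J. ((\<lambda>k\<in>I j. restrict (m j (s' j k)) (X j)), restrict (s j) (I j)))"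
  have "bij_betw (s j) (I j) (I j)" if "j \<in> J" for j
    using that s s' ss by (intro bij_betw_byWitness[of _ "s' j"]) auto
  moreover have "restrict (m j i) (X j) \<in> carrier (C j)" if j: "j \<in> J" and i: "i \<in> I j" for j i
  proof -
    have "bij_betw (m j i) (X j) (X j)"
      using 1[OF j i] 2[OF j s[OF j i]] m[OF j i] m'[OF j s[OF j i]] ss[OF j i]
      by (intro bij_betw_byWitness[of _ "m' j (s j i)"]) auto
    moreover have "m j i (\<phi> g y) = \<phi> g (m j i y)" if g: "g \<in> carrier G" and y: "y \<in> X j" for g y
    proof -
      have "t j (s j i) (m j i (\<phi> g y)) = f (\<phi> g (t j i y))"
        using fc[OF j i X_closed[OF j g y]] eqv[OF j i y g] by simp
      also have "\<dots> = \<phi> g (f (t j i y))"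
        using f g t_mem[OF j i y] by (auto simp: mem_action_aut_group)
      also have "\<dots> = t j (s j i) (\<phi> g (m j i y))"
        using fc[OF j i y] eqv[OF j s[OF j i] m[OF j i y] g] by simp
      finally show ?thesis
        using t_inject j i y g s m X_closed by blast
    qed
    ultimately show ?thesis using j X_closed by (auto simp: mem_C Bij_def)
  qed
  ultimately have F: "F \<in> carrier P" using s' by (auto simp: mem_P F_def Bij_def)
  have "assemble F = f"
  proof (rule extensionalityI)
    show "assemble F \<in> extensional E" "f \<in> extensional E"
      using f by (auto simp: assemble_def mem_action_aut_group Bij_def)
    fix w assume "w \<in> E"
    then obtain j i y where "j \<in> J" "i \<in> I j" "y \<in> X j" "w = t j i y" by (rule t_cases)
    then show "assemble F w = f w" using s ss by (simp add: assemble_apply fc) (simp add: F_def)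
  qed
  with F show ?thesis by blast
qed

theorem action_aut_group_iso_product:
  "action_aut_group G E \<phi> \<cong> product_group J (\<lambda>j. wreath_Sym (C j) (I j))"
proof -
  interpret P: group P by (rule group_P)
  have "assemble (F \<otimes>\<^bsub>P\<^esub> H) = assemble F \<otimes>\<^bsub>action_aut_group G E \<phi>\<^esub> assemble H"
    if "F \<in> carrier P" "H \<in> carrier P" for F H
    using that assemble_mult[OF that]
    by (intro extensionalityI[of _ E])
       (auto simp: assemble_aut mult_action_aut_group compose_eq assemble_extensional)
  then have "assemble \<in> iso P (action_aut_group G E \<phi>)"
    using assemble_inj assemble_aut assemble_surj
    by (auto simp: iso_def hom_def bij_betw_def)
  then show ?thesis unfolding P_def[symmetric] using P.iso_sym is_isoI by blast
qed

end

section \<open>Automorphism groups of arbitrary actions\<close>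

theorem mainTheorem5:
  fixes \<Gamma> :: "('g, 'm) monoid_scheme"
    and \<Omega> :: "'a set"
    and \<theta> :: "'g \<Rightarrow> 'a \<Rightarrow> 'a"
    and J :: "'j set"
    and I :: "'j \<Rightarrow> 'i set"
    and Orb :: "'j \<Rightarrow> 'i \<Rightarrow> 'a set"
  assumes "group_action \<Gamma> \<Omega> \<theta>"
    and "components_by_iso_class \<Gamma> \<Omega> \<theta> J I Orb"
  shows "(\<forall>j\<in>J. \<forall>i\<in>I j. \<forall>x\<in>Orb j i.
            orbit_centraliser \<Gamma> \<theta> (Orb j i) \<cong>
            \<Gamma>\<lparr>carrier := normalizer \<Gamma> (stabilizer \<Gamma> \<theta> x)\<rparr> Mod stabilizer \<Gamma> \<theta> x) \<and>
         (\<forall>r. (\<forall>j\<in>J. r j \<in> I j) \<longrightarrow>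
            action_aut_group \<Gamma> \<Omega> \<theta> \<cong>
            product_group J (\<lambda>j. wreath_Sym (orbit_centraliser \<Gamma> \<theta> (Orb j (r j))) (I j)))"
proof (intro conjI ballI allI impI)
  interpret group_action \<Gamma> \<Omega> \<theta> by fact
  have bij: "bij_betw (\<lambda>(j, i). Orb j i) (Sigma J I) (orbits \<Gamma> \<Omega> \<theta>)"
    and iso: "\<And>j i j' i'. \<lbrakk>j \<in> J; i \<in> I j; j' \<in> J; i' \<in> I j'\<rbrakk> \<Longrightarrow>
      isomorphic_actions \<Gamma> (Orb j i) (restrict_action \<theta> (Orb j i))
        (Orb j' i') (restrict_action \<theta> (Orb j' i')) \<longleftrightarrow> j = j'"
    using assms(2) by (auto simp: components_by_iso_class_def)
  have orb: "Orb j i \<in> orbits \<Gamma> \<Omega> \<theta>" if "j \<in> J" "i \<in> I j" for j i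
    using bij that by (force simp: bij_betw_def)
  have orbE: "\<exists>j\<in>J. \<exists>i\<in>I j. Y = Orb j i" if "Y \<in> orbits \<Gamma> \<Omega> \<theta>" for Y
  proof -
    have "Y \<in> (\<lambda>(j, i). Orb j i) ` Sigma J I"
      using bij_betw_imp_surj_on[OF bij] that by simp
    then show ?thesis by auto
  qed
  have orb_inj: "j = j' \<and> i = i'"
    if "Orb j i \<inter> Orb j' i' \<noteq> {}" "j \<in> J" "i \<in> I j" "j' \<in> J" "i' \<in> I j'" for j i j' i'
  proof -
    have "Orb j i = Orb j' i'" using that disjoint_union orb by blast
    then show ?thesis
      using that inj_onD[OF bij_betw_imp_inj_on[OF bij], of "(j, i)" "(j', i')"] by auto
  qed
  {
    fix j i x assume j: "j \<in> J" and i: "i \<in> I j" and x: "x \<in> Orb j i"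
    have "stabilizer \<Gamma> (restrict_action \<theta> (Orb j i)) x = stabilizer \<Gamma> \<theta> x"
      using x by (auto simp: stabilizer_def restrict_action_def)
    then show "orbit_centraliser \<Gamma> \<theta> (Orb j i) \<cong>
        \<Gamma>\<lparr>carrier := normalizer \<Gamma> (stabilizer \<Gamma> \<theta> x)\<rparr> Mod stabilizer \<Gamma> \<theta> x"
      using transitive_action.action_aut_group_iso_normalizer_quotient
          [OF transitive_restrict_action[OF orb[OF j i]] x]
      by (simp add: orbit_centraliser_eq orb[OF j i])
  }
  fix r assume r: "\<forall>j\<in>J. r j \<in> I j"
  have "\<exists>f. bij_betw f (Orb j (r j)) (Orb j i) \<and>
      (\<forall>g\<in>carrier \<Gamma>. \<forall>x\<in>Orb j (r j). f (\<theta> g x) = \<theta> g (f x))" if "j \<in> J" "i \<in> I j" for j i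
    using that r iso[of j "r j" j i] by (simp add: isomorphic_orbits_iff orb)
  then obtain t where t: "\<And>j i. \<lbrakk>j \<in> J; i \<in> I j\<rbrakk> \<Longrightarrow> bij_betw (t j i) (Orb j (r j)) (Orb j i)"
    and t_eqv: "\<And>j i g x. \<lbrakk>j \<in> J; i \<in> I j; g \<in> carrier \<Gamma>; x \<in> Orb j (r j)\<rbrakk>
      \<Longrightarrow> t j i (\<theta> g x) = \<theta> g (t j i x)"
    by metis
  have t_mem: "t j i y \<in> Orb j i" if "j \<in> J" "i \<in> I j" "y \<in> Orb j (r j)" for j i y
    using t that by (blast dest: bij_betwE)
  have t_onto: "\<exists>y\<in>Orb j (r j). w = t j i y" if "j \<in> J" "i \<in> I j" "w \<in> Orb j i" for j i w
    using bij_betw_imp_surj_on[OF t[OF that(1,2)]] that(3) by blast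
  interpret component_coordinates \<Gamma> \<Omega> \<theta> J I "\<lambda>j. Orb j (r j)" t
  proof
    show "Orb j (r j) \<in> orbits \<Gamma> \<Omega> \<theta>" if "j \<in> J" for j using that r orb by blast
    show "t j i (\<theta> g y) = \<theta> g (t j i y)"
      if "j \<in> J" "i \<in> I j" "y \<in> Orb j (r j)" "g \<in> carrier \<Gamma>" for j i y g
      using that t_eqv by blast
    show "bij_betw (\<lambda>(j, i, y). t j i y) (SIGMA j:J. I j \<times> Orb j (r j)) \<Omega>"
      unfolding bij_betw_def
    proof
      show "inj_on (\<lambda>(j, i, y). t j i y) (SIGMA j:J. I j \<times> Orb j (r j))"
      proof (rule inj_onI)
        fix p q
        assume p: "p \<in> (SIGMA j:J. I j \<times> Orb j (r j))" and q: "q \<in> (SIGMA j:J. I j \<times> Orb j (r j))"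
          and eq: "(case p of (j, i, y) \<Rightarrow> t j i y) = (case q of (j, i, y) \<Rightarrow> t j i y)"
        obtain j i y where pc: "p = (j, i, y)" by (cases p)
        obtain j' i' y' where qc: "q = (j', i', y')" by (cases q)
        have *: "j \<in> J" "i \<in> I j" "y \<in> Orb j (r j)" "j' \<in> J" "i' \<in> I j'" "y' \<in> Orb j' (r j')"
          "t j i y = t j' i' y'"
          using p q eq pc qc by auto
        have "t j i y \<in> Orb j i" using t_mem[OF *(1-3)] .
        moreover have "t j i y \<in> Orb j' i'" using t_mem[OF *(4-6)] *(7) by simp
        ultimately have ji: "j = j'" "i = i'" using orb_inj[OF _ *(1,2,4,5)] by blast+
        have "inj_on (t j i) (Orb j (r j))" using bij_betw_imp_inj_on[OF t[OF *(1,2)]] .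
        then have "y = y'" using *(3,6,7) ji by (auto dest: inj_onD)
        then show "p = q" using pc qc ji by simp
      qed
      show "(\<lambda>(j, i, y). t j i y) ` (SIGMA j:J. I j \<times> Orb j (r j)) = \<Omega>"
      proof
        show "(\<lambda>(j, i, y). t j i y) ` (SIGMA j:J. I j \<times> Orb j (r j)) \<subseteq> \<Omega>"
          using orbit_subset_carrier[OF orb] t_mem by fastforce
        show "\<Omega> \<subseteq> (\<lambda>(j, i, y). t j i y) ` (SIGMA j:J. I j \<times> Orb j (r j))"
        proof
          fix w assume "w \<in> \<Omega>"
          then obtain Y where Y: "Y \<in> orbits \<Gamma> \<Omega> \<theta>" "w \<in> Y" using orbits_coverture by blast
          then obtain j i where ji: "j \<in> J" "i \<in> I j" "w \<in> Orb j i"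
            using orbE[OF Y(1)] by blast
          then obtain y where "y \<in> Orb j (r j)" "w = t j i y" using t_onto[OF ji] by blast
          with ji show "w \<in> (\<lambda>(j, i, y). t j i y) ` (SIGMA j:J. I j \<times> Orb j (r j))"
            by (intro image_eqI[of _ _ "(j, i, y)"]) auto
        qed
      qed
    qed
    show "\<exists>k\<in>I j. \<exists>z\<in>Orb j (r j). f (t j i y) = t j k z"
      if f: "f \<in> carrier (action_aut_group \<Gamma> \<Omega> \<theta>)" and j: "j \<in> J" and i: "i \<in> I j"
        and y: "y \<in> Orb j (r j)" for f j i y
    proof -
      note img = action_aut_image_orbit[OF f orb[OF j i]]
      obtain j' k where k: "j' \<in> J" "k \<in> I j'" "f ` Orb j i = Orb j' k" using orbE[OF img(1)] by blast
      then have j': "j' = j" using img(2) iso[OF j i k(1,2)] by simp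
      have "f (t j i y) \<in> Orb j k" using k(3) j' t_mem[OF j i y] by blast
      moreover have kI: "k \<in> I j" using k(2) j' by simp
      ultimately obtain z where "z \<in> Orb j (r j)" "f (t j i y) = t j k z"
        using t_onto[OF j] by blast
      then show ?thesis using kI by blast
    qed
  qed
  show "action_aut_group \<Gamma> \<Omega> \<theta> \<cong>
      product_group J (\<lambda>j. wreath_Sym (orbit_centraliser \<Gamma> \<theta> (Orb j (r j))) (I j))"
    by (rule action_aut_group_iso_product)
qed

end
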